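(* Let $\{\mu^{(i)}\}_{i\in\mathbb{N}_0}\subset\mathcal{P}=\mathbb{R}^p$ be an infinite sequence of iterates generated by the Hermite kernel trust-region (HKTR) algorithm described in the context, under the standing assumptions listed there, with constants $\kappa_{\mathrm{arm}}\in(0,1)$ and $\kappa_{\mathrm{bt}}\in(0,1)$. Suppose that $k(\mu,\cdot)$ is Lipschitz continuous uniformly in $\mu$, i.e. there is $C_k<\infty$ with $|k(\mu,\tilde\mu)-k(\mu,\mu')|\le C_k\|\tilde\mu-\mu'\|$ for all $\mu,\tilde\mu,\mu'\in\mathcal{P}$. Suppose that there are constants $\Phi<\frac{\pi}{2}$, $c_l>0$, $C_c>0$, $C_{\nabla\hat J}>0$ such that for every $i\in\mathbb{N}_0$: 1. $\Phi^{(i)}\le\Phi<\frac{\pi}{2}$, where $\Phi^{(i)}$ is the angle between $-\nabla\hat J^{(i)}(\mu^{(i)})$ and $p^{(i)}$; 2. $c^{(i)}(\mu^{(i)})\ge c_l>0$; 3. $|c^{(i)}(\mu)-c^{(i)}(\tilde\mu)|\le C_c^{(i)}\|\mu-\tilde\mu\|^{1/2}$ for all $\mu,\tilde\mu\in\mathcal{P}$, with $0<C_c^{(i)}\le C_c$; 4. $\|\nabla\hat J^{(i)}(\mu)-\nabla\hat J^{(i)}(\tilde\mu)\|\le C_{\nabla\hat J}^{(i)}\|\mu-\tilde\mu\|$ for all $\mu,\tilde\mu\in\mathcal{P}$, with $0<C_{\nabla\hat J}^{(i)}<C_{\nabla\hat J}$. If the sufficient decrease condition $$J(\mu^{(i+1)})\le\hat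 J^{(i)}(\mu^{(i)}_{\mathrm{AGC}})$$ holds for all iterations $i$, then $$\lim_{i\to\infty}\|\nabla J(\mu^{(i)})\|=0.$$
   Context: $\|\cdot\|$ is the Euclidean norm and $\mathcal{P}=\mathbb{R}^p$. Kernel setting. $k\in C^2(\mathcal{P}\times\mathcal{P})$ is a strictly positive definite (s.p.d.) kernel: symmetric, with positive definite Gram matrix $(k(x_i,x_j))_{i,j}$ for every finite set of pairwise distinct points. $\mathcal{H}_k(\mathcal{P})$ is its reproducing kernel Hilbert space (RKHS). $\partial_1^a$, for a multi-index $a\in\mathbb{N}_0^p$ with $\|a\|_1\le1$, is the partial derivative with respect to the first argument of $k$ (no derivative if $a=0$). For a finite set $X\subset\mathcal{P}$ of pairwise distinct points, $V(X):=\operatorname{span}\{\partial_1^a k(x,\cdot): x\in X,\ a\in\mathbb{N}_0^p,\ \|a\|_1\le1\}\subset\mathcal{H}_k(\mathcal{P})$ and $\Pi_{V(X)}$ is the orthogonal projection of $\mathcal{H}_k(\mathcal{P})$ onto $V(X)$. The Power function is $P_X(\mu):=\|(I-\Pi_{V(X)})k(\mu,\cdot)\|_{\mathcal{H}_k(\mathcal{P})}$. Surrogates. $J:\mathcal{P}\to\mathbb{R}$ is the objective function to be minimized. At iteration $i$, $M^{(i)}$ is the finite set of interpolation points, consisting of the iterates $\mu^{(0)},\dots,\mu^{(i)}$ (together with those rejected trial points at which $J$ and $\nabla J$ were evaluated, see below). The surrogate is the Hermite kernel interpolant $\hat J^{(i)}:=\Pi_{V(M^{(i)})}J$, which interpolates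 the values and gradients of $J$ at the points of $M^{(i)}$. Standing assumptions on $J$ and $\hat J^{(i)}$: (a) $\hat J^{(i)}$ is twice differentiable for all $i$; (b) there is $c>0$ with $J(\mu)>c$ for all $\mu\in\mathcal{P}$; (c) there is $c>0$ with $\hat J^{(i)}(\mu)>c$ for all $\mu\in\mathcal{P}$ and all $i$; (d) $J\in\mathcal{H}_k(\mathcal{P})$; (e) for all $i$, $\hat J^{(i)}$ and $\nabla\hat J^{(i)}$ are Lipschitz continuous on $\mathcal{P}$. Trust region. $\delta^{(i)}>0$ is the trust-region radius, $\eta^{(i)}(\mu):=\|J\|_{\mathcal{H}_k(\mathcal{P})}P_{M^{(i)}}(\mu)$, and $c^{(i)}(\mu):=\delta^{(i)}-\eta^{(i)}(\mu)/\hat J^{(i)}(\mu)$. The trust region is $\{\mu\in\mathcal{P}: c^{(i)}(\mu)\ge0\}$. The subproblem is $\min_{\mu\in\mathcal{P}}\hat J^{(i)}(\mu)$ subject to $c^{(i)}(\mu)\ge0$. Approximated generalized Cauchy (AGC) point. $p^{(i)}$ is the first search (descent) direction used at $\mu^{(i)}$ (commonly chosen as the negative gradient at $\mu^{(i)}$), and $\Phi^{(i)}$ is the angle between $-\nabla\hat J^{(i)}(\mu^{(i)})$ and $p^{(i)}$, i.e. $\langle\nabla\hat J^{(i)}(\mu^{(i)}),p^{(i)}\rangle=-\|\nabla\hat J^{(i)}(\mu^{(i)})\|\,\|p^{(i)}\|\cos\Phi^{(i)}$. Put $\mu^{(i)}(j):=\mu^{(i)}+\kappa_{\mathrm{bt}}^j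 p^{(i)}$. Then $\mu_{\mathrm{AGC}}^{(i)}:=\mu^{(i)}(j)$ for the smallest $j\in\mathbb{N}_0$ with $$\hat J^{(i)}(\mu^{(i)}(j))-\hat J^{(i)}(\mu^{(i)})\le-\kappa_{\mathrm{arm}}\|\nabla\hat J^{(i)}(\mu^{(i)})\|\,\|\mu^{(i)}-\mu^{(i)}(j)\|\cos\Phi^{(i)}\quad\text{and}\quad c^{(i)}(\mu^{(i)}(j))\ge0.$$ HKTR algorithm. Given $\mu^{(i)},\delta^{(i)},\hat J^{(i)}$, a descent method (BFGS) is started at $\mu^{(i)}$ for the subproblem; its first iterate is $\mu^{(i)}_{\mathrm{AGC}}$, and further iterates are obtained by the same backtracking rule from the current inner iterate along new descent directions; its last iterate is the trial point $\mu^{(i+1)}$. The trial point is accepted if $\hat J^{(i)}(\mu^{(i+1)})+\eta^{(i)}(\mu^{(i+1)})\le\hat J^{(i)}(\mu^{(i)}_{\mathrm{AGC}})$; otherwise it is rejected if $\hat J^{(i)}(\mu^{(i+1)})-\eta^{(i)}(\mu^{(i+1)})>\hat J^{(i)}(\mu^{(i)}_{\mathrm{AGC}})$; otherwise $J(\mu^{(i+1)})$ and $\nabla J(\mu^{(i+1)})$ are evaluated, this data is added to the surrogate, and the point is accepted if and only if $J(\mu^{(i+1)})\le\hat J^{(i)}(\mu^{(i)}_{\mathrm{AGC}})$. On rejection, $\delta^{(i)}$ is multiplied by a factor $\beta_1\in(0,1)$ and the subproblem is solved again for the same $i$. On acceptance, $\hat J^{(i+1)}$ is built with $\mu^{(i+1)}$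 among its interpolation points, and with $\rho^{(i)}:=\frac{J(\mu^{(i)})-J(\mu^{(i+1)})}{\hat J^{(i)}(\mu^{(i)})-\hat J^{(i)}(\mu^{(i+1)})}$ and constants $0<\xi_1<\xi_2<1$, $\beta\in(0,1)$, one sets $\delta^{(i+1)}=\beta^{-1}\delta^{(i)}$ if $\rho^{(i)}\ge\xi_2$, $\delta^{(i+1)}=\delta^{(i)}$ if $\rho^{(i)}\in[\xi_1,\xi_2)$, and $\delta^{(i+1)}=\beta\delta^{(i)}$ if $\rho^{(i)}<\xi_1$. Finite termination tests are ignored, as the sequence of iterates is assumed infinite.
   Formalization: Added assumption: for every e>0 there is r>0 such that the first search direction p^(i) has norm at least r whenever the surrogate gradient at μ^(i) has norm at least e; without it, arbitrarily short descent directions make the claim false. *)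

theory Defs
  imports "HOL-Analysis.Analysis"
begin

section \<open>Differentiability\<close>

definition grad :: "('a::real_inner \<Rightarrow> real) \<Rightarrow> 'a \<Rightarrow> 'a" where
  "grad f x = (THE D. GDERIV f x :> D)"

definition twice_differentiable :: "('a::real_normed_vector \<Rightarrow> real) \<Rightarrow> bool" where
  "twice_differentiable f \<longleftrightarrow>
     (\<exists>f' :: 'a \<Rightarrow> 'a \<Rightarrow>\<^sub>L real.
        (\<forall>x. (f has_derivative blinfun_apply (f' x)) (at x)) \<and>
        (\<forall>x. f' differentiable (at x)))"

definition C2 :: "('a::real_normed_vector \<Rightarrow> real) \<Rightarrow> bool" where
  "C2 f \<longleftrightarrow>
     (\<exists>(f' :: 'a \<Rightarrow> 'a \<Rightarrow>\<^sub>L real) (f'' :: 'a \<Rightarrow> 'a \<Rightarrow>\<^sub>L ('a \<Rightarrow>\<^sub>L real)).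
        (\<forall>x. (f has_derivative blinfun_apply (f' x)) (at x)) \<and>
        (\<forall>x. (f' has_derivative blinfun_apply (f'' x)) (at x)) \<and>
        continuous_on UNIV f'')"

section \<open>Kernels and their native spaces\<close>

definition spd_kernel :: "('a \<Rightarrow> 'a \<Rightarrow> real) \<Rightarrow> bool" where
  "spd_kernel k \<longleftrightarrow>
     (\<forall>x y. k x y = k y x) \<and>
     (\<forall>X c. finite X \<longrightarrow> (\<exists>x\<in>X. c x \<noteq> 0) \<longrightarrow>
        (\<Sum>x\<in>X. \<Sum>y\<in>X. c x * c y * k x y) > 0)"

(* The reproducing kernel Hilbert space of k is a Hilbert space of functions. Here it is given
   by a Hilbert space type 'h together with the evaluation map ev :: 'h => 'a => real, an
   injective linear map into the functions: h is identified with the function ev h, the space is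
   the set of functions "range ev", and "inv ev f" is the element that is the function f. *)
definition rkhs :: "('a \<Rightarrow> 'a \<Rightarrow> real) \<Rightarrow> ('h::{real_inner,complete_space} \<Rightarrow> 'a \<Rightarrow> real) \<Rightarrow> bool" where
  "rkhs k ev \<longleftrightarrow>
     inj ev \<and>
     (\<forall>x. linear (\<lambda>h. ev h x)) \<and>
     (\<forall>x. k x \<in> range ev) \<and>
     (\<forall>h x. ev h x = inner h (inv ev (k x)))"

definition orth_proj :: "'h::real_inner set \<Rightarrow> 'h \<Rightarrow> 'h" where
  "orth_proj V f = (THE g. g \<in> V \<and> (\<forall>h\<in>V. inner (f - g) h = 0))"

text \<open>The function \<open>y \<mapsto> \<partial>k(x,y)/\<partial>x\<^sub>i\<close>.\<close>

definition partial1 :: "(real^'p \<Rightarrow> real^'p \<Rightarrow> real) \<Rightarrow> 'p \<Rightarrow> real^'p \<Rightarrow> real^'p \<Rightarrow> real" where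
  "partial1 k i x = (\<lambda>y. deriv (\<lambda>t. k (x + t *\<^sub>R axis i 1) y) 0)"

(* The multi-indices of order at most 1 are 0 and the unit vectors. *)
definition hermite_space ::
  "('h::{real_inner,complete_space} \<Rightarrow> real^'p \<Rightarrow> real) \<Rightarrow> (real^'p \<Rightarrow> real^'p \<Rightarrow> real) \<Rightarrow>
   (real^'p) set \<Rightarrow> 'h set" where
  "hermite_space ev k X =
     span {h. \<exists>x\<in>X. ev h = k x \<or> (\<exists>i. ev h = partial1 k i x)}"

definition power_fun ::
  "('h::{real_inner,complete_space} \<Rightarrow> real^'p \<Rightarrow> real) \<Rightarrow> (real^'p \<Rightarrow> real^'p \<Rightarrow> real) \<Rightarrow>
   (real^'p) set \<Rightarrow> real^'p \<Rightarrow> real" where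
  "power_fun ev k X \<mu> =
     norm (inv ev (k \<mu>) - orth_proj (hermite_space ev k X) (inv ev (k \<mu>)))"

section \<open>Surrogate, error indicator and trust-region constraint\<close>

definition surrogate ::
  "('h::{real_inner,complete_space} \<Rightarrow> real^'p \<Rightarrow> real) \<Rightarrow> (real^'p \<Rightarrow> real^'p \<Rightarrow> real) \<Rightarrow>
   (real^'p \<Rightarrow> real) \<Rightarrow> (real^'p) set \<Rightarrow> real^'p \<Rightarrow> real" where
  "surrogate ev k J M = ev (orth_proj (hermite_space ev k M) (inv ev J))"

definition err ::
  "('h::{real_inner,complete_space} \<Rightarrow> real^'p \<Rightarrow> real) \<Rightarrow> (real^'p \<Rightarrow> real^'p \<Rightarrow> real) \<Rightarrow>
   (real^'p \<Rightarrow> real) \<Rightarrow> (real^'p) set \<Rightarrow> real^'p \<Rightarrow> real" where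
  "err ev k J M \<mu> = norm (inv ev J) * power_fun ev k M \<mu>"

definition tr_constr ::
  "('h::{real_inner,complete_space} \<Rightarrow> real^'p \<Rightarrow> real) \<Rightarrow> (real^'p \<Rightarrow> real^'p \<Rightarrow> real) \<Rightarrow>
   (real^'p \<Rightarrow> real) \<Rightarrow> (real^'p) set \<Rightarrow> real \<Rightarrow> real^'p \<Rightarrow> real" where
  "tr_constr ev k J M \<delta> \<mu> = \<delta> - err ev k J M \<mu> / surrogate ev k J M \<mu>"

section \<open>The descent method for the subproblem\<close>

(* A relation rather than a function: if u = 0 or v = 0, any value in [0, pi] is admitted. *)
definition is_angle :: "real \<Rightarrow> 'a::real_inner \<Rightarrow> 'a \<Rightarrow> bool" where
  "is_angle \<theta> u v \<longleftrightarrow> 0 \<le> \<theta> \<and> \<theta> \<le> pi \<and> inner u v = norm u * norm v * cos \<theta>"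

definition bt_admissible ::
  "(real^'p \<Rightarrow> real) \<Rightarrow> (real^'p \<Rightarrow> real) \<Rightarrow> real \<Rightarrow> real^'p \<Rightarrow> real \<Rightarrow> real^'p \<Rightarrow> bool" where
  "bt_admissible Jh c \<kappa>arm x \<theta> y \<longleftrightarrow>
     Jh y - Jh x \<le> - \<kappa>arm * norm (grad Jh x) * norm (x - y) * cos \<theta> \<and> c y \<ge> 0"

(* y is the backtracking iterate from x along the descent direction d, which makes the angle
   \<theta> with the negative gradient. At a stationary point x, where no descent direction exists,
   any d is admitted; this only enlarges the set of runs of the algorithm. *)
definition bt_step ::
  "(real^'p \<Rightarrow> real) \<Rightarrow> (real^'p \<Rightarrow> real) \<Rightarrow> real \<Rightarrow> real \<Rightarrow>
   real^'p \<Rightarrow> real^'p \<Rightarrow> real \<Rightarrow> real^'p \<Rightarrow> bool" where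
  "bt_step Jh c \<kappa>arm \<kappa>bt x d \<theta> y \<longleftrightarrow>
     is_angle \<theta> (- grad Jh x) d \<and>
     (grad Jh x \<noteq> 0 \<longrightarrow> inner (grad Jh x) d < 0) \<and>
     (\<exists>j. y = x + \<kappa>bt ^ j *\<^sub>R d \<and>
          bt_admissible Jh c \<kappa>arm x \<theta> (x + \<kappa>bt ^ j *\<^sub>R d) \<and>
          (\<forall>j'<j. \<not> bt_admissible Jh c \<kappa>arm x \<theta> (x + \<kappa>bt ^ j' *\<^sub>R d)))"

(* A run of the descent method from x: first direction p at angle \<phi>, first iterate a (the
   approximated generalized Cauchy point), last iterate t (the trial point). Only the
   backtracking rule and the descent property of the directions are prescribed, so that BFGS
   with any inner stopping rule is covered. *)
definition descent_run ::
  "(real^'p \<Rightarrow> real) \<Rightarrow> (real^'p \<Rightarrow> real) \<Rightarrow> real \<Rightarrow> real \<Rightarrow>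
   real^'p \<Rightarrow> real^'p \<Rightarrow> real \<Rightarrow> real^'p \<Rightarrow> real^'p \<Rightarrow> bool" where
  "descent_run Jh c \<kappa>arm \<kappa>bt x p \<phi> a t \<longleftrightarrow>
     (\<exists>(L::nat) z d \<theta>. 1 \<le> L \<and>
        z 0 = x \<and> z 1 = a \<and> z L = t \<and> d 0 = p \<and> \<theta> 0 = \<phi> \<and>
        (\<forall>l<L. bt_step Jh c \<kappa>arm \<kappa>bt (z l) (d l) (\<theta> l) (z (Suc l))))"

section \<open>The Hermite kernel trust-region algorithm\<close>

definition cheap_accept ::
  "('h::{real_inner,complete_space} \<Rightarrow> real^'p \<Rightarrow> real) \<Rightarrow> (real^'p \<Rightarrow> real^'p \<Rightarrow> real) \<Rightarrow>
   (real^'p \<Rightarrow> real) \<Rightarrow> (real^'p) set \<Rightarrow> real^'p \<Rightarrow> real^'p \<Rightarrow> bool" where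
  "cheap_accept ev k J M a t \<longleftrightarrow>
     surrogate ev k J M t + err ev k J M t \<le> surrogate ev k J M a"

definition cheap_reject ::
  "('h::{real_inner,complete_space} \<Rightarrow> real^'p \<Rightarrow> real) \<Rightarrow> (real^'p \<Rightarrow> real^'p \<Rightarrow> real) \<Rightarrow>
   (real^'p \<Rightarrow> real) \<Rightarrow> (real^'p) set \<Rightarrow> real^'p \<Rightarrow> real^'p \<Rightarrow> bool" where
  "cheap_reject ev k J M a t \<longleftrightarrow>
     surrogate ev k J M t - err ev k J M t > surrogate ev k J M a"

definition accepted ::
  "('h::{real_inner,complete_space} \<Rightarrow> real^'p \<Rightarrow> real) \<Rightarrow> (real^'p \<Rightarrow> real^'p \<Rightarrow> real) \<Rightarrow>
   (real^'p \<Rightarrow> real) \<Rightarrow> (real^'p) set \<Rightarrow> real^'p \<Rightarrow> real^'p \<Rightarrow> bool" where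
  "accepted ev k J M a t \<longleftrightarrow>
     cheap_accept ev k J M a t \<or>
     (\<not> cheap_reject ev k J M a t \<and> J t \<le> surrogate ev k J M a)"

(* One rejected attempt at the iterate x. It changes the interpolation points and the radius;
   the points change exactly if J and its gradient had to be evaluated at the trial point. *)
definition rejected_attempt ::
  "('h::{real_inner,complete_space} \<Rightarrow> real^'p \<Rightarrow> real) \<Rightarrow> (real^'p \<Rightarrow> real^'p \<Rightarrow> real) \<Rightarrow>
   (real^'p \<Rightarrow> real) \<Rightarrow> real \<Rightarrow> real \<Rightarrow> real \<Rightarrow> real^'p \<Rightarrow>
   (real^'p) set \<times> real \<Rightarrow> (real^'p) set \<times> real \<Rightarrow> bool" where
  "rejected_attempt ev k J \<kappa>arm \<kappa>bt \<beta>1 x = (\<lambda>(M, \<delta>) (M', \<delta>').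
     \<exists>p \<phi> a t.
       descent_run (surrogate ev k J M) (tr_constr ev k J M \<delta>) \<kappa>arm \<kappa>bt x p \<phi> a t \<and>
       \<not> accepted ev k J M a t \<and>
       M' = (if cheap_reject ev k J M a t then M else insert t M) \<and>
       \<delta>' = \<beta>1 * \<delta>)"

definition radius_update :: "real \<Rightarrow> real \<Rightarrow> real \<Rightarrow> real \<Rightarrow> real \<Rightarrow> real" where
  "radius_update \<xi>1 \<xi>2 \<beta> \<rho> \<delta> =
     (if \<rho> \<ge> \<xi>2 then inverse \<beta> * \<delta> else if \<rho> \<ge> \<xi>1 then \<delta> else \<beta> * \<delta>)"

(* \<mu> is an infinite sequence of iterates. M i, \<delta> i, p i, \<phi> i, a i are the interpolation
   points, radius, first direction, its angle and the AGC point of the attempt of iteration i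
   whose trial point \<mu> (Suc i) is accepted; M0 i and \<delta>0 i are the values of points and
   radius with which iteration i starts, before any rejections. *)
definition hktr ::
  "('h::{real_inner,complete_space} \<Rightarrow> real^'p \<Rightarrow> real) \<Rightarrow> (real^'p \<Rightarrow> real^'p \<Rightarrow> real) \<Rightarrow>
   (real^'p \<Rightarrow> real) \<Rightarrow> real \<Rightarrow> real \<Rightarrow> real \<Rightarrow> real \<Rightarrow> real \<Rightarrow> real \<Rightarrow>
   (nat \<Rightarrow> real^'p) \<Rightarrow> (nat \<Rightarrow> (real^'p) set) \<Rightarrow> (nat \<Rightarrow> real) \<Rightarrow>
   (nat \<Rightarrow> real^'p) \<Rightarrow> (nat \<Rightarrow> real) \<Rightarrow> (nat \<Rightarrow> real^'p) \<Rightarrow> bool" where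
  "hktr ev k J \<kappa>arm \<kappa>bt \<beta>1 \<beta> \<xi>1 \<xi>2 \<mu> M \<delta> p \<phi> a \<longleftrightarrow>
     (\<exists>M0 \<delta>0. M0 0 = {\<mu> 0} \<and> 0 < \<delta>0 0 \<and>
       (\<forall>i. (rejected_attempt ev k J \<kappa>arm \<kappa>bt \<beta>1 (\<mu> i))\<^sup>*\<^sup>* (M0 i, \<delta>0 i) (M i, \<delta> i) \<and>
            descent_run (surrogate ev k J (M i)) (tr_constr ev k J (M i) (\<delta> i)) \<kappa>arm \<kappa>bt
              (\<mu> i) (p i) (\<phi> i) (a i) (\<mu> (Suc i)) \<and>
            accepted ev k J (M i) (a i) (\<mu> (Suc i)) \<and>
            M0 (Suc i) = insert (\<mu> (Suc i)) (M i) \<and>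
            \<delta>0 (Suc i) = radius_update \<xi>1 \<xi>2 \<beta>
              ((J (\<mu> i) - J (\<mu> (Suc i))) /
               (surrogate ev k J (M i) (\<mu> i) - surrogate ev k J (M i) (\<mu> (Suc i))))
              (\<delta> i)))"

end

theory Submission
  imports Defs
begin

text \<open>
  Since \<open>k\<close> is \<open>C\<^sup>2\<close>, the feature map \<open>x \<mapsto> k x\<close> into the native space is differentiable and its
  partial derivatives are the functions \<open>partial1 k i x\<close>. So the residual of the projection, being
  orthogonal to the Hermite space, has vanishing value and gradient at every interpolation point;
  in particular the surrogate agrees with \<open>J\<close> to first order at \<open>\<mu> i\<close>.

  If the gradient at \<open>\<mu> i\<close> has norm at least \<open>e\<close>, the AGC step has length at least some \<open>\<sigma>(e) > 0\<close>:
  either there was no backtracking and the step is \<open>p i\<close>, or the step before the last reduction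
  violated the Armijo condition (impossible for short steps, as the gradient is Lipschitz) or the
  constraint (impossible for short steps, as the constraint is at least \<open>cl\<close> at \<open>\<mu> i\<close> and Hoelder
  continuous). Then \<open>J\<close> decreases by a fixed amount, which happens only finitely often because
  \<open>J\<close> is bounded below.
\<close>

section \<open>Differentiability and orthogonal projection\<close>

text \<open>Two applications of the mean value theorem turn the mixed second difference into a mixed
  second derivative at an intermediate point; continuity of \<open>f''\<close> at
  \<open>(x, x)\<close> compares it with \<open>B\<close>, the value on the diagonal. The error is
  bounded by the product of both norms, so it survives rescaling \<open>v\<close> and
  \<open>w\<close> independently.\<close>

lemma C2_mixed_difference:
  fixes k :: "'a::real_normed_vector \<Rightarrow> 'a \<Rightarrow> real"
  assumes "C2 (\<lambda>(x, y). k x y)"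
  obtains B where "bilinear B"
    and "\<And>e. e > 0 \<Longrightarrow> \<exists>d>0. \<forall>v w. norm v < d \<longrightarrow> norm w < d \<longrightarrow>
      \<bar>k (x + v) (x + w) - k (x + v) x - k x (x + w) + k x x - B v w\<bar> \<le> e * norm v * norm w"
proof -
  obtain f' :: "'a \<times> 'a \<Rightarrow> ('a \<times> 'a) \<Rightarrow>\<^sub>L real"
    and f'' :: "'a \<times> 'a \<Rightarrow> ('a \<times> 'a) \<Rightarrow>\<^sub>L (('a \<times> 'a) \<Rightarrow>\<^sub>L real)"
    where f': "\<And>z. ((\<lambda>(x, y). k x y) has_derivative blinfun_apply (f' z)) (at z)"
      and f'': "\<And>z. (f' has_derivative blinfun_apply (f'' z)) (at z)"
      and cont: "continuous_on UNIV f''"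
    using assms unfolding C2_def by blast
  define B where "B v w = f'' (x, x) (0, w) (v, 0)" for v w
  have mean_value: "\<exists>s\<in>{0<..<1}. \<exists>t\<in>{0<..<1}. k (x + v) (x + w) - k (x + v) x - k x (x + w) + k x x
      = f'' (x + s *\<^sub>R v, x + t *\<^sub>R w) (0, w) (v, 0)" for v w
  proof -
    define K where "K = (\<lambda>(x, y). k x y)"
    note K' = f'[folded K_def]
    \<comment> \<open>The first argument is varied first: the function of \<open>s\<close> is
      already a difference in the second argument, so one intermediate \<open>s\<close> serves both
      terms.\<close>
    have "((\<lambda>s. K (x + s *\<^sub>R v, x + w) - K (x + s *\<^sub>R v, x)) has_derivative
        (\<lambda>h. f' (x + s *\<^sub>R v, x + w) (h *\<^sub>R v, 0) - f' (x + s *\<^sub>R v, x) (h *\<^sub>R v, 0)))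
        (at s within {0..1})" for s :: real
      by (rule has_derivative_diff; rule has_derivative_compose[OF _ K'])
        (auto intro!: derivative_eq_intros)
    from mvt_simple[OF zero_less_one this] obtain s where s: "s \<in> {0<..<1}"
      and 1: "K (x + v, x + w) - K (x + v, x) - (K (x, x + w) - K (x, x))
        = f' (x + s *\<^sub>R v, x + w) (v, 0) - f' (x + s *\<^sub>R v, x) (v, 0)"
      by auto
    have "((\<lambda>t. f' (x + s *\<^sub>R v, x + t *\<^sub>R w)) has_derivative
        (\<lambda>h. f'' (x + s *\<^sub>R v, x + t *\<^sub>R w) (0, h *\<^sub>R w))) (at t within {0..1})" for t :: real
      by (rule has_derivative_compose[OF _ f'']) (auto intro!: derivative_eq_intros)
    from bounded_linear.has_derivative[OF blinfun.bounded_linear_left this]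
    have "((\<lambda>t. f' (x + s *\<^sub>R v, x + t *\<^sub>R w) (v, 0)) has_derivative
        (\<lambda>h. f'' (x + s *\<^sub>R v, x + t *\<^sub>R w) (0, h *\<^sub>R w) (v, 0))) (at t within {0..1})" for t :: real .
    from mvt_simple[OF zero_less_one this] obtain t where t: "t \<in> {0<..<1}"
      and 2: "f' (x + s *\<^sub>R v, x + w) (v, 0) - f' (x + s *\<^sub>R v, x) (v, 0)
        = f'' (x + s *\<^sub>R v, x + t *\<^sub>R w) (0, w) (v, 0)"
      by auto
    have "k (x + v) (x + w) - k (x + v) x - k x (x + w) + k x x
      = f'' (x + s *\<^sub>R v, x + t *\<^sub>R w) (0, w) (v, 0)"
      using 1 2 by (simp add: K_def)
    with s t show ?thesis by blast
  qed
  show ?thesis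
  proof
    have "f'' (x, x) (0, c *\<^sub>R w) (v, 0) = c *\<^sub>R f'' (x, x) (0, w) (v, 0)"
      "f'' (x, x) (0, w) (c *\<^sub>R v, 0) = c *\<^sub>R f'' (x, x) (0, w) (v, 0)" for c v w
      using blinfun.scaleR_right[of "f'' (x, x)" c "(0, w)"]
        blinfun.scaleR_right[of "f'' (x, x) (0, w)" c "(v, 0)"]
      by (auto simp: blinfun.scaleR_left)
    moreover have "f'' (x, x) (0, w + w') (v, 0) = f'' (x, x) (0, w) (v, 0) + f'' (x, x) (0, w') (v, 0)"
      "f'' (x, x) (0, w) (v + v', 0) = f'' (x, x) (0, w) (v, 0) + f'' (x, x) (0, w) (v', 0)" for v w v' w'
      using blinfun.add_right[of "f'' (x, x)" "(0, w)" "(0, w')"]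
        blinfun.add_right[of "f'' (x, x) (0, w)" "(v, 0)" "(v', 0)"]
      by (auto simp: blinfun.add_left)
    ultimately show "bilinear B"
      by (auto simp: bilinear_def B_def intro!: linearI)
  next
    fix e :: real
    assume "e > 0"
    moreover have "isCont f'' (x, x)"
      using cont by (simp add: continuous_on_eq_continuous_at)
    ultimately obtain d where d: "d > 0" "\<And>z. dist z (x, x) < d \<Longrightarrow> dist (f'' z) (f'' (x, x)) < e"
      unfolding continuous_at_eps_delta by blast
    \<comment> \<open>The intermediate point is at distance at most \<open>norm v + norm w\<close>
      from \<open>(x, x)\<close>, hence the radius \<open>d / 2\<close> for each increment.\<close>
    have "\<bar>k (x + v) (x + w) - k (x + v) x - k x (x + w) + k x x - B v w\<bar> \<le> e * norm v * norm w"
      if vw: "norm v < d / 2" "norm w < d / 2" for v w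
    proof -
      obtain s t where st: "s \<in> {0<..<1}" "t \<in> {0<..<1}"
        and eq: "k (x + v) (x + w) - k (x + v) x - k x (x + w) + k x x
          = f'' (x + s *\<^sub>R v, x + t *\<^sub>R w) (0, w) (v, 0)"
        using mean_value by blast
      define z where "z = (x + s *\<^sub>R v, x + t *\<^sub>R w)"
      have "dist z (x, x) \<le> norm (s *\<^sub>R v) + norm (t *\<^sub>R w)"
        using norm_Pair_le[of "s *\<^sub>R v" "t *\<^sub>R w"] by (simp only: z_def dist_norm) simp
      also have "\<dots> \<le> norm v + norm w"
        using st by (auto intro!: add_mono mult_left_le_one_le)
      also have "\<dots> < d" using vw by simp
      finally have "norm (f'' z - f'' (x, x)) < e" using d by (simp add: dist_norm)
      moreover have "norm ((f'' z - f'' (x, x)) (0, w) (v, 0))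
          \<le> norm (f'' z - f'' (x, x)) * norm w * norm v"
        using norm_blinfun[of "(f'' z - f'' (x, x)) (0, w)" "(v, 0)"]
          norm_blinfun[of "f'' z - f'' (x, x)" "(0, w)"]
        by (simp add: norm_Pair) (meson mult_right_mono norm_ge_zero order_trans)
      ultimately have "norm ((f'' z - f'' (x, x)) (0, w) (v, 0)) \<le> e * norm w * norm v"
        by (meson less_imp_le mult_right_mono norm_ge_zero order_trans)
      then show ?thesis
        unfolding eq B_def z_def[symmetric] by (simp add: blinfun.diff_left mult_ac)
    qed
    then show "\<exists>d>0. \<forall>v w. norm v < d \<longrightarrow> norm w < d \<longrightarrow>
      \<bar>k (x + v) (x + w) - k (x + v) x - k x (x + w) + k x x - B v w\<bar> \<le> e * norm v * norm w"
      using \<open>d > 0\<close> by (intro exI[of _ "d / 2"]) auto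
  qed
qed

text \<open>The Gram matrix of increments, being close to a bilinear form, makes the difference quotients
  Cauchy.\<close>
lemma differentiable_from_gram:
  fixes \<kappa> :: "'a::euclidean_space \<Rightarrow> 'h::{real_inner,complete_space}"
  assumes B: "bilinear B"
    and gram: "\<And>e. e > 0 \<Longrightarrow> \<exists>d>0. \<forall>v w. norm v < d \<longrightarrow> norm w < d \<longrightarrow>
      \<bar>inner (\<kappa> (x + v) - \<kappa> x) (\<kappa> (x + w) - \<kappa> x) - B v w\<bar> \<le> e * norm v * norm w"
  shows "\<kappa> differentiable (at x)"
proof -
  define \<psi> where "\<psi> v = \<kappa> (x + v) - \<kappa> x" for v
  \<comment> \<open>Difference quotients of step \<open>1 / (n + 1)\<close> in direction
    \<open>v\<close>; their limit will be the derivative.\<close>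
  define q where "q v n = real (Suc n) *\<^sub>R \<psi> (v /\<^sub>R real (Suc n))" for v n
  \<comment> \<open>By bilinearity the factors \<open>a\<close> and \<open>b\<close> cancel in the
    error bound. Separate factors allow comparing quotients of different steps, and with
    \<open>a = 1\<close> an increment with a quotient.\<close>
  have scaled: "\<bar>inner (\<psi> (v /\<^sub>R a) ) (\<psi> (w /\<^sub>R b)) * a * b - B v w\<bar> \<le> e * norm v * norm w"
    if "\<forall>v w. norm v < d \<longrightarrow> norm w < d \<longrightarrow> \<bar>inner (\<psi> v) (\<psi> w) - B v w\<bar> \<le> e * norm v * norm w"
      "norm v < d * a" "norm w < d * b" "a > 0" "b > 0" for v w d e a b
  proof -
    have "\<bar>inner (\<psi> (v /\<^sub>R a)) (\<psi> (w /\<^sub>R b)) - B (v /\<^sub>R a) (w /\<^sub>R b)\<bar>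
        \<le> e * norm (v /\<^sub>R a) * norm (w /\<^sub>R b)"
    proof -
      have "norm (v /\<^sub>R a) < d" "norm (w /\<^sub>R b) < d"
        using that(2-5) by (simp_all add: field_simps)
      then show ?thesis using that(1) by blast
    qed
    then have "\<bar>inner (\<psi> (v /\<^sub>R a)) (\<psi> (w /\<^sub>R b)) - B (v /\<^sub>R a) (w /\<^sub>R b)\<bar> * (a * b)
        \<le> e * norm (v /\<^sub>R a) * norm (w /\<^sub>R b) * (a * b)"
      using that by (intro mult_right_mono) auto
    also have "\<dots> = e * norm v * norm w"
      using that by (simp add: field_simps)
    also have "\<bar>inner (\<psi> (v /\<^sub>R a)) (\<psi> (w /\<^sub>R b)) - B (v /\<^sub>R a) (w /\<^sub>R b)\<bar> * (a * b)
        = \<bar>(inner (\<psi> (v /\<^sub>R a)) (\<psi> (w /\<^sub>R b)) - B (v /\<^sub>R a) (w /\<^sub>R b)) * (a * b)\<bar>"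
      using that by (simp add: abs_mult)
    also have "(inner (\<psi> (v /\<^sub>R a)) (\<psi> (w /\<^sub>R b)) - B (v /\<^sub>R a) (w /\<^sub>R b)) * (a * b)
        = inner (\<psi> (v /\<^sub>R a) ) (\<psi> (w /\<^sub>R b)) * a * b - B v w"
      using that by (simp add: bilinear_lmul[OF B] bilinear_rmul[OF B] field_simps)
    finally show ?thesis .
  qed
  have large: "\<exists>N. \<forall>n\<ge>N. norm v < d * real (Suc n)" if "d > 0" for v :: 'a and d
  proof -
    obtain N where "norm v / d < real N" using reals_Archimedean2 by blast
    moreover have "norm v / d < real (Suc n)" if "norm v / d < real N" "n \<ge> N" for n
      using that by linarith
    ultimately show ?thesis using that by (metis mult.commute pos_divide_less_eq)
  qed
  have inner_q: "\<exists>N. \<forall>n\<ge>N. \<forall>m\<ge>N. \<bar>inner (q v n) (q w m) - B v w\<bar> \<le> e * norm v * norm w"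
    if e: "e > 0" for v w e
  proof -
    obtain d where d: "d > 0" and g: "\<forall>v w. norm v < d \<longrightarrow> norm w < d \<longrightarrow>
        \<bar>inner (\<psi> v) (\<psi> w) - B v w\<bar> \<le> e * norm v * norm w"
      using gram[OF e] unfolding \<psi>_def by blast
    obtain N1 N2 where "\<forall>n\<ge>N1. norm v < d * real (Suc n)" "\<forall>n\<ge>N2. norm w < d * real (Suc n)"
      using large[OF d] by metis
    then show ?thesis
      using scaled[OF g] by (intro exI[of _ "max N1 N2"]) (auto simp: q_def mult_ac)
  qed
  have "Cauchy (q v)" for v
  proof (rule metric_CauchyI)
    fix e :: real
    assume "e > 0"
    \<comment> \<open>The squared distance of two quotients expands into four errors of size
      \<open>c * norm v * norm v\<close>; the 5 and the \<open>+ 1\<close> keep their sum strictly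
      below \<open>e\<^sup>2\<close> even for \<open>v = 0\<close>.\<close>
    define c where "c = e\<^sup>2 / (5 * (norm v * norm v + 1))"
    have "norm v * norm v + 1 > 0" by (simp add: add_nonneg_pos)
    then have "c > 0" and c: "4 * (c * norm v * norm v) < e\<^sup>2"
    proof -
      show "c > 0" using \<open>e > 0\<close> \<open>norm v * norm v + 1 > 0\<close> by (simp add: c_def)
      then have "4 * (c * norm v * norm v) < 5 * (c * (norm v * norm v + 1))"
        by (simp add: algebra_simps add_pos_nonneg)
      also have "\<dots> = e\<^sup>2"
        using \<open>norm v * norm v + 1 > 0\<close> by (simp add: c_def divide_simps)
      finally show "4 * (c * norm v * norm v) < e\<^sup>2" .
    qed
    obtain N where N: "\<And>n m. n \<ge> N \<Longrightarrow> m \<ge> N \<Longrightarrow> \<bar>inner (q v n) (q v m) - B v v\<bar> \<le> c * norm v * norm v"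
      using inner_q[OF \<open>c > 0\<close>] by blast
    have "dist (q v m) (q v n) < e" if "m \<ge> N" "n \<ge> N" for m n
    proof -
      have "(norm (q v m - q v n))\<^sup>2 = inner (q v m) (q v m) - 2 * inner (q v m) (q v n) + inner (q v n) (q v n)"
        by (simp add: power2_norm_eq_inner inner_diff inner_commute)
      also have "\<dots> \<le> 4 * (c * norm v * norm v)"
        using N[OF that(1) that(1), THEN abs_le_D1] N[OF that, THEN abs_le_D2]
          N[OF that(2) that(2), THEN abs_le_D1] by linarith
      also note c
      finally show ?thesis using \<open>e > 0\<close> by (simp add: dist_norm power2_less_imp_less)
    qed
    then show "\<exists>N. \<forall>m\<ge>N. \<forall>n\<ge>N. dist (q v m) (q v n) < e" by blast
  qed
  then obtain L where L: "\<And>v. q v \<longlonglongrightarrow> L v"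
    unfolding Cauchy_convergent_iff convergent_def by metis
  have inner_L: "inner (L v) (L w) = B v w" for v w
  proof (rule LIMSEQ_unique)
    show "(\<lambda>n. inner (q v n) (q w n)) \<longlonglongrightarrow> inner (L v) (L w)" by (intro tendsto_intros L)
    show "(\<lambda>n. inner (q v n) (q w n)) \<longlonglongrightarrow> B v w"
    proof (rule metric_LIMSEQ_I)
      fix e :: real
      assume "e > 0"
      define c where "c = e / (norm v * norm w + 1)"
      have "norm v * norm w + 1 > 0" by (simp add: add_nonneg_pos)
      then have "c > 0" "c * norm v * norm w < e"
        using \<open>e > 0\<close> by (auto simp: c_def field_simps)
      with inner_q[OF \<open>c > 0\<close>, of v w]
      show "\<exists>N. \<forall>n\<ge>N. dist (inner (q v n) (q w n)) (B v w) < e"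
        unfolding dist_real_def by (meson order_le_less_trans)
    qed
  qed
  \<comment> \<open>Since inner products of values of \<open>L\<close> are given by
    \<open>B\<close>, each linearity defect has squared norm zero by bilinearity of
    \<open>B\<close>.\<close>
  have "linear L"
  proof (rule linearI)
    show "L (v + w) = L v + L w" for v w
    proof -
      have "inner (L (v + w) - (L v + L w)) (L (v + w) - (L v + L w)) = 0"
        by (simp add: inner_diff inner_add inner_L bilinear_ladd[OF B] bilinear_radd[OF B])
      then show ?thesis by simp
    qed
    show "L (c *\<^sub>R v) = c *\<^sub>R L v" for c v
    proof -
      have "inner (L (c *\<^sub>R v) - c *\<^sub>R L v) (L (c *\<^sub>R v) - c *\<^sub>R L v) = 0"
        by (simp add: inner_diff inner_L bilinear_lmul[OF B] bilinear_rmul[OF B])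
      then show ?thesis by simp
    qed
  qed
  have "(\<kappa> has_derivative L) (at x)"
    unfolding has_derivative_at_alt
  proof (intro conjI allI impI)
    show "bounded_linear L" using \<open>linear L\<close> by (simp add: linear_conv_bounded_linear)
    fix e :: real
    assume "e > 0"
    \<comment> \<open>Expanding the squared remainder gives three errors: one from comparing
      \<open>inner (\<psi> v) (\<psi> v)\<close> with \<open>B v v\<close>, and two from the mixed
      term \<open>inner (\<psi> v) (L v)\<close>.\<close>
    define c where "c = e\<^sup>2 / 3"
    have "c > 0" using \<open>e > 0\<close> by (simp add: c_def)
    obtain d where d: "d > 0" and g: "\<forall>v w. norm v < d \<longrightarrow> norm w < d \<longrightarrow>
        \<bar>inner (\<psi> v) (\<psi> w) - B v w\<bar> \<le> c * norm v * norm w"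
      using gram[OF \<open>c > 0\<close>] unfolding \<psi>_def by blast
    have "norm (\<psi> v - L v) \<le> e * norm v" if v: "norm v < d" for v
    proof -
      obtain N where N: "\<forall>n\<ge>N. norm v < d * real (Suc n)" using large[OF d] by blast
      \<comment> \<open>Only one factor is rescaled here; letting \<open>n\<close> grow replaces the
        quotient by \<open>L v\<close>.\<close>
      have "\<bar>inner (\<psi> v) (q v n) - B v v\<bar> \<le> c * norm v * norm v" if "n \<ge> N" for n
        using scaled[OF g, of v 1 v "real (Suc n)"] v N that by (simp add: q_def mult_ac)
      moreover have "(\<lambda>n. \<bar>inner (\<psi> v) (q v n) - B v v\<bar>) \<longlonglongrightarrow> \<bar>inner (\<psi> v) (L v) - B v v\<bar>"
        by (intro tendsto_intros L)
      ultimately have 1: "\<bar>inner (\<psi> v) (L v) - B v v\<bar> \<le> c * norm v * norm v"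
        using LIMSEQ_le_const2 by blast
      have 2: "\<bar>inner (\<psi> v) (\<psi> v) - B v v\<bar> \<le> c * norm v * norm v" using g v by blast
      have "(norm (\<psi> v - L v))\<^sup>2 = inner (\<psi> v) (\<psi> v) - 2 * inner (\<psi> v) (L v) + B v v"
        by (simp add: power2_norm_eq_inner inner_diff inner_commute inner_L)
      also have "\<dots> \<le> 3 * (c * norm v * norm v)" using 1[THEN abs_le_D2] 2[THEN abs_le_D1] by linarith
      also have "\<dots> = (e * norm v)\<^sup>2" by (simp add: c_def power2_eq_square)
      finally show ?thesis by (rule power2_le_imp_le) (use \<open>e > 0\<close> in simp)
    qed
    from this[of "y - x" for y] d
    show "\<exists>d>0. \<forall>y. norm (y - x) < d \<longrightarrow> norm (\<kappa> y - \<kappa> x - L (y - x)) \<le> e * norm (y - x)"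
      by (auto simp: \<psi>_def)
  qed
  then show ?thesis by (auto simp: differentiable_def)
qed

text \<open>A Gram-Schmidt induction: the projection is corrected along the part \<open>r\<close> of
  the new generator that is orthogonal to the old span.\<close>

lemma orthogonal_projection_exists:
  fixes S :: "'h::real_inner set"
  assumes "finite S"
  shows "\<exists>g\<in>span S. \<forall>h\<in>span S. inner (f - g) h = 0"
  using assms
proof (induction S arbitrary: f rule: finite_induct)
  case empty
  then show ?case by simp
next
  case (insert s S)
  obtain g where g: "g \<in> span S" "\<forall>h\<in>span S. inner (f - g) h = 0"
    using insert.IH by blast
  obtain t where t: "t \<in> span S" "\<forall>h\<in>span S. inner (s - t) h = 0"
    using insert.IH by blast
  define r where "r = s - t"
  \<comment> \<open>If \<open>s\<close> already lies in the old span, then \<open>r = 0\<close> and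
    the quotient is 0 by convention, so \<open>g' = g\<close>.\<close>
  define g' where "g' = g + (inner (f - g) r / inner r r) *\<^sub>R r"
  have sub: "span S \<subseteq> span (insert s S)" by (rule span_mono) auto
  have r_mem: "r \<in> span (insert s S)"
    unfolding r_def using t(1) sub by (auto intro: span_diff span_base)
  have orth_r: "inner (f - g') r = 0"
    by (simp add: g'_def inner_diff_left inner_add_left)
  have orth_S: "inner (f - g') h = 0" if "h \<in> span S" for h
    using that g(2) t(2) by (simp add: g'_def r_def inner_diff_left inner_add_left)
  have "inner (f - g') s = 0"
    using orth_r orth_S[OF t(1)] by (simp add: r_def inner_diff_right)
  then have "inner (f - g') h = 0" if "h \<in> span (insert s S)" for h
    using orthogonal_to_span[OF that, of "f - g'"] orth_S span_base
    by (auto simp: orthogonal_def)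
  moreover have "g' \<in> span (insert s S)"
    unfolding g'_def using g(1) sub r_mem by (auto intro: span_add span_scale)
  ultimately show ?case by blast
qed

text \<open>This unfolds the definite description in \<open>orth_proj\<close>. Uniqueness holds
  because the difference of two candidates lies in the span and is orthogonal to itself.\<close>

lemma orth_proj_span:
  fixes S :: "'h::real_inner set"
  assumes "finite S" "h \<in> span S"
  shows "inner (orth_proj (span S) f) h = inner f h"
proof -
  let ?P = "\<lambda>g. g \<in> span S \<and> (\<forall>h\<in>span S. inner (f - g) h = 0)"
  obtain g where g: "?P g" using orthogonal_projection_exists[OF assms(1)] by blast
  have "g' = g" if "?P g'" for g'
  proof -
    have "g' - g \<in> span S" using g that by (simp add: span_diff)
    then have "inner (f - g) (g' - g) - inner (f - g') (g' - g) = 0" using g that by simp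
    then have "inner (g' - g) (g' - g) = 0" by (simp add: inner_diff_left)
    then show ?thesis by simp
  qed
  then have "orth_proj (span S) f = g"
    unfolding orth_proj_def by (intro the_equality g)
  then show ?thesis using g assms(2) by (simp add: inner_diff_left)
qed

section \<open>Gradients and a first-order Taylor bound\<close>

lemma grad_eqI: "GDERIV f x :> D \<Longrightarrow> grad f x = D"
  unfolding grad_def
proof (rule the_equality)
  fix D' assume "GDERIV f x :> D" "GDERIV f x :> D'"
  then have "(\<lambda>h. inner h D') = (\<lambda>h. inner h D)"
    unfolding gderiv_def by (blast intro: has_derivative_unique)
  then have "inner h D' = inner h D" for h by meson
  then show "D' = D" using vector_eq_rdot[of D' D] by (simp add: inner_commute)
qed

text \<open>The Riesz representer written in coordinates; the explicit sum lets gradients be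
  compared through derivatives along basis vectors.\<close>

lemma GDERIV_exists:
  fixes f :: "'a::euclidean_space \<Rightarrow> real"
  assumes "(f has_derivative f') (at x)"
  shows "GDERIV f x :> (\<Sum>b\<in>Basis. f' b *\<^sub>R b)"
proof -
  have "linear f'" using assms by (simp add: has_derivative_linear)
  have "f' h = inner h (\<Sum>b\<in>Basis. f' b *\<^sub>R b)" for h
  proof -
    have "f' h = f' (\<Sum>b\<in>Basis. inner h b *\<^sub>R b)" by (simp add: euclidean_representation)
    also have "\<dots> = (\<Sum>b\<in>Basis. inner h b * f' b)"
      using \<open>linear f'\<close> by (simp add: linear_sum linear_scale)
    finally show ?thesis by (simp add: inner_sum_right mult.commute)
  qed
  from has_derivative_eq_rhs[OF assms ext, OF this] show ?thesis
    unfolding gderiv_def .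
qed

text \<open>The mean value theorem replaces the usual integral, which gives the constant
  \<open>C\<close> instead of \<open>C / 2\<close>.\<close>

lemma descent_lemma:
  fixes f :: "'a::real_inner \<Rightarrow> real"
  assumes deriv: "\<And>z. GDERIV f z :> grad f z"
    and Lip: "\<And>y z. norm (grad f y - grad f z) \<le> C * norm (y - z)"
    and C: "C \<ge> 0"
  shows "f (x + v) - f x \<le> inner (grad f x) v + C * (norm v)\<^sup>2"
proof -
  have "((\<lambda>t. f (x + t *\<^sub>R v)) has_derivative (\<lambda>h. inner (h *\<^sub>R v) (grad f (x + t *\<^sub>R v))))
      (at t within {0..1})" for t :: real
    by (rule has_derivative_compose[OF _ deriv[unfolded gderiv_def]])
      (auto intro!: derivative_eq_intros)
  from mvt_simple[OF zero_less_one this] obtain t where t: "t \<in> {0<..<1}"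
    and eq: "f (x + v) - f x = inner v (grad f (x + t *\<^sub>R v))"
    by auto
  have "inner v (grad f (x + t *\<^sub>R v) - grad f x) \<le> norm v * norm (grad f (x + t *\<^sub>R v) - grad f x)"
    by (rule norm_cauchy_schwarz)
  also have "\<dots> \<le> norm v * (C * norm (t *\<^sub>R v))"
    using Lip[of "x + t *\<^sub>R v" x] by (intro mult_left_mono) auto
  also have "\<dots> \<le> norm v * (C * norm v)"
    using t C by (intro mult_left_mono) (auto intro!: mult_left_le_one_le)
  finally show ?thesis
    unfolding eq by (simp add: inner_diff_right inner_commute power2_eq_square mult_ac)
qed

section \<open>Hermite interpolation in the native space\<close>

lemma rkhs_reproducing:
  assumes "rkhs k ev"
  shows "ev h x = inner h (inv ev (k x))" and "ev (inv ev (k x)) = k x"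
  using assms unfolding rkhs_def by (auto simp: f_inv_into_f)

lemma rkhs_inner_kernel:
  assumes "rkhs k ev"
  shows "inner (inv ev (k x)) (inv ev (k y)) = k x y"
  using rkhs_reproducing[OF assms] by metis

text \<open>By the reproducing property, the Gram matrix of increments of the feature map is the
  mixed second difference of \<open>k\<close>.\<close>

lemma feature_map_differentiable:
  fixes k :: "'a::euclidean_space \<Rightarrow> 'a \<Rightarrow> real"
    and ev :: "'h::{real_inner,complete_space} \<Rightarrow> 'a \<Rightarrow> real"
  assumes k: "C2 (\<lambda>(x, y). k x y)" and ev: "rkhs k ev"
  shows "(\<lambda>x. inv ev (k x)) differentiable (at x)"
proof -
  obtain B where B: "bilinear B"
    and small: "\<And>e. e > 0 \<Longrightarrow> \<exists>d>0. \<forall>v w. norm v < d \<longrightarrow> norm w < d \<longrightarrow>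
      \<bar>k (x + v) (x + w) - k (x + v) x - k x (x + w) + k x x - B v w\<bar> \<le> e * norm v * norm w"
    using C2_mixed_difference[OF k] by blast
  have "inner (inv ev (k (x + v)) - inv ev (k x)) (inv ev (k (x + w)) - inv ev (k x))
      = k (x + v) (x + w) - k (x + v) x - k x (x + w) + k x x" for v w
    by (simp add: inner_diff rkhs_inner_kernel[OF ev])
  with differentiable_from_gram[OF B, of "\<lambda>x. inv ev (k x)" x] small show ?thesis by simp
qed

lemma native_function_has_derivative:
  assumes ev: "rkhs k ev" and D: "((\<lambda>x. inv ev (k x)) has_derivative D) (at x)"
  shows "(ev h has_derivative (\<lambda>v. inner h (D v))) (at x)"
proof -
  have "((\<lambda>x. inner h (inv ev (k x))) has_derivative (\<lambda>v. inner h (D v))) (at x)"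
    using D by (rule has_derivative_inner_right)
  moreover have "(\<lambda>x. inner h (inv ev (k x))) = ev h"
    using rkhs_reproducing[OF ev] by auto
  ultimately show ?thesis by simp
qed

lemma native_function_GDERIV:
  fixes k :: "'a::euclidean_space \<Rightarrow> 'a \<Rightarrow> real"
  assumes "C2 (\<lambda>(x, y). k x y)" "rkhs k ev"
  shows "GDERIV (ev h) x :> grad (ev h) x"
proof -
  obtain D where "((\<lambda>x. inv ev (k x)) has_derivative D) (at x)"
    using feature_map_differentiable[OF assms] unfolding differentiable_def by blast
  from GDERIV_exists[OF native_function_has_derivative[OF assms(2) this]] show ?thesis
    using grad_eqI by metis
qed

text \<open>\<open>hermite_space\<close> collects only those elements whose function is some
  \<open>partial1 k i x\<close>; this identity shows that such elements exist in the native space,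
  namely the partial derivatives of the feature map.\<close>

lemma ev_derivative_eq_partial1:
  fixes k :: "real^'p \<Rightarrow> real^'p \<Rightarrow> real"
  assumes ev: "rkhs k ev" and D: "((\<lambda>x. inv ev (k x)) has_derivative D) (at x)"
  shows "ev (D (axis i 1)) = partial1 k i x"
proof
  fix y
  define b :: "real^'p" where "b = axis i 1"
  have "((\<lambda>t. x + t *\<^sub>R b) has_derivative (\<lambda>t. t *\<^sub>R b)) (at 0)"
    by (auto intro!: derivative_eq_intros)
  from has_derivative_compose[OF this, of "\<lambda>x. inv ev (k x)" D] D
  have "((\<lambda>t. inv ev (k (x + t *\<^sub>R b))) has_derivative (\<lambda>t. D (t *\<^sub>R b))) (at 0)"
    by simp
  then have "((\<lambda>t. inner (inv ev (k (x + t *\<^sub>R b))) (inv ev (k y))) has_derivative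
      (\<lambda>t. inner (D (t *\<^sub>R b)) (inv ev (k y)))) (at 0)"
    by (rule has_derivative_inner_left)
  then have "((\<lambda>t. k (x + t *\<^sub>R b) y) has_derivative (\<lambda>t. ev (D b) y * t)) (at 0)"
    using has_derivative_linear[OF D]
    by (simp add: rkhs_inner_kernel[OF ev] linear_scale rkhs_reproducing(1)[OF ev] mult.commute)
  then have "DERIV (\<lambda>t. k (x + t *\<^sub>R b) y) 0 :> ev (D b) y"
    by (simp add: has_field_derivative_def)
  then show "ev (D (axis i 1)) y = partial1 k i x y"
    unfolding partial1_def b_def by (simp add: DERIV_imp_deriv)
qed

text \<open>Injectivity of \<open>ev\<close> gives at most one generator per function. Finiteness is
  what \<open>orth_proj_span\<close> asks for.\<close>

lemma finite_hermite_generators: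
  fixes k :: "real^'p \<Rightarrow> real^'p \<Rightarrow> real"
  assumes "inj ev" "finite X"
  shows "finite {h. \<exists>x\<in>X. ev h = k x \<or> (\<exists>i. ev h = partial1 k i x)}"
proof -
  have "{h. \<exists>x\<in>X. ev h = k x \<or> (\<exists>i. ev h = partial1 k i x)}
      = ev -` (\<Union>x\<in>X. insert (k x) (range (\<lambda>i. partial1 k i x)))"
    by (rule set_eqI) (simp add: image_iff)
  also have "finite \<dots>" using assms by (intro finite_vimageI) auto
  finally show ?thesis .
qed

lemma surrogate_interpolates:
  fixes k :: "real^'p \<Rightarrow> real^'p \<Rightarrow> real"
  assumes k: "C2 (\<lambda>(x, y). k x y)" and ev: "rkhs k ev"
    and J: "J \<in> range ev" and X: "finite X" "x \<in> X"
  shows "surrogate ev k J X x = J x" and "grad (surrogate ev k J X) x = grad J x"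
proof -
  have inj: "inj ev" using ev by (simp add: rkhs_def)
  define S where "S = {h. \<exists>x\<in>X. ev h = k x \<or> (\<exists>i. ev h = partial1 k i x)}"
  define f where "f = inv ev J"
  define g where "g = orth_proj (span S) f"
  have J_eq: "ev f = J" using J by (simp add: f_def f_inv_into_f)
  have surr: "surrogate ev k J X = ev g"
    by (simp add: surrogate_def hermite_space_def S_def f_def g_def)
  have proj: "inner g h = inner f h" if "h \<in> span S" for h
    using orth_proj_span[OF _ that] finite_hermite_generators[OF inj X(1)]
    by (simp add: g_def S_def)
  have "inv ev (k x) \<in> S" using X rkhs_reproducing(2)[OF ev] by (auto simp: S_def)
  then have "ev g x = ev f x"
    by (simp add: rkhs_reproducing(1)[OF ev] proj span_base)
  then show "surrogate ev k J X x = J x" by (simp add: surr J_eq)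
  obtain D where D: "((\<lambda>x. inv ev (k x)) has_derivative D) (at x)"
    using feature_map_differentiable[OF k ev] unfolding differentiable_def by blast
  \<comment> \<open>\<open>D (axis i 1)\<close> represents the partial derivative at
    \<open>x\<close> on the native space, so projecting onto a span that contains it preserves that
    derivative.\<close>
  have "D (axis i 1) \<in> S" for i
    using ev_derivative_eq_partial1[OF ev D] X by (auto simp: S_def)
  then have "inner g (D b) = inner f (D b)" if "b \<in> Basis" for b
    using that by (auto simp: Basis_vec_def intro!: proj span_base)
  then have "(\<Sum>b\<in>Basis. inner g (D b) *\<^sub>R b) = (\<Sum>b\<in>Basis. inner f (D b) *\<^sub>R b)"
    by simp
  then have "grad (ev g) x = grad (ev f) x"
    using GDERIV_exists[OF native_function_has_derivative[OF ev D], THEN grad_eqI] by simp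
  then show "grad (surrogate ev k J X) x = grad J x" by (simp add: surr J_eq)
qed

section \<open>Sufficient decrease\<close>

lemma cos_le_cos_acute:
  fixes x y :: real
  assumes "0 \<le> x" "x \<le> y" "y < pi / 2"
  shows "0 < cos y" and "cos y \<le> cos x"
  using assms pi_gt_zero by (auto intro!: cos_monotone_0_pi_le intro: cos_gt_zero_pi)

text \<open>The bound depends on the iterate only through uniform constants. Its terms match the
  cases: no backtracking, previous step outside the trust region, previous step violating the Armijo
  condition.\<close>

lemma bt_step_length:
  fixes f c :: "real^'p \<Rightarrow> real"
  assumes step: "bt_step f c \<kappa>arm \<kappa>bt x p \<phi> a"
    and const: "0 < \<kappa>arm" "\<kappa>arm < 1" "0 < \<kappa>bt" "\<kappa>bt < 1"
    and deriv: "\<And>z. GDERIV f z :> grad f z"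
    and Lip: "\<And>y z. norm (grad f y - grad f z) \<le> C * norm (y - z)" and C: "C > 0"
    and angle: "\<phi> \<le> \<Phi>" "\<Phi> < pi / 2"
    and c_x: "c x \<ge> cl" and cl: "cl > 0"
    and Hoelder: "\<And>y z. \<bar>c y - c z\<bar> \<le> Cc * sqrt (norm (y - z))" and Cc: "Cc > 0"
    and grad_large: "norm (grad f x) \<ge> e" and e: "e > 0"
    and p_large: "norm p \<ge> r"
  shows "norm (x - a) \<ge> min r (\<kappa>bt * min ((cl / Cc)\<^sup>2) ((1 - \<kappa>arm) * e * cos \<Phi> / C))"
proof -
  let ?adm = "\<lambda>j. bt_admissible f c \<kappa>arm x \<phi> (x + \<kappa>bt ^ j *\<^sub>R p)"
  obtain j where a: "a = x + \<kappa>bt ^ j *\<^sub>R p" and fail: "\<And>j'. j' < j \<Longrightarrow> \<not> ?adm j'"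
    and phi: "is_angle \<phi> (- grad f x) p"
    using step unfolding bt_step_def by blast
  have cos: "cos \<Phi> \<le> cos \<phi>" "0 < cos \<Phi>"
    using phi angle cos_le_cos_acute[of \<phi> \<Phi>] by (auto simp: is_angle_def)
  show ?thesis
  proof (cases j)
    case 0
    then show ?thesis using a p_large by simp
  next
    case (Suc l)
    \<comment> \<open>\<open>v\<close> is the last inadmissible step; the accepted one is
      \<open>\<kappa>bt\<close> times as long.\<close>
    define v where "v = \<kappa>bt ^ l *\<^sub>R p"
    define s where "s = norm v"
    have length_a: "norm (x - a) = \<kappa>bt * s" using const by (simp add: a Suc s_def v_def)
    have "\<not> bt_admissible f c \<kappa>arm x \<phi> (x + v)" using fail[of l] Suc by (simp add: v_def)
    then consider "c (x + v) < 0"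
      | "f (x + v) - f x > - \<kappa>arm * norm (grad f x) * s * cos \<phi>"
      by (auto simp: bt_admissible_def s_def)
    then have "min ((cl / Cc)\<^sup>2) ((1 - \<kappa>arm) * e * cos \<Phi> / C) \<le> s"
    proof cases
      case 1
      then have "cl \<le> Cc * sqrt s"
        using c_x Hoelder[of x "x + v"] by (simp add: s_def)
      then have "cl / Cc \<le> sqrt s" using Cc by (simp add: field_simps)
      then have "(cl / Cc)\<^sup>2 \<le> (sqrt s)\<^sup>2" using cl Cc by (intro power_mono) auto
      then show ?thesis by (simp add: s_def)
    next
      case 2
      have "inner (- grad f x) v = norm (grad f x) * s * cos \<phi>"
        using phi const by (simp add: is_angle_def v_def s_def)
      then have "f (x + v) - f x \<le> - norm (grad f x) * s * cos \<phi> + C * s\<^sup>2"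
        using descent_lemma[of f C x v, OF deriv Lip] C by (simp add: s_def)
      with 2 have "(1 - \<kappa>arm) * norm (grad f x) * cos \<phi> * s < C * s * s"
        by (simp add: algebra_simps power2_eq_square)
      \<comment> \<open>Nonnegativity suffices to cancel \<open>s\<close>: the reverse inequality
        multiplied by \<open>s\<close> would contradict the strict one.\<close>
      moreover have "s \<ge> 0" by (simp add: s_def)
      ultimately have "(1 - \<kappa>arm) * norm (grad f x) * cos \<phi> < C * s"
        using mult_right_mono by (meson not_le order_le_less_trans)
      moreover have "(1 - \<kappa>arm) * e * cos \<Phi> \<le> (1 - \<kappa>arm) * norm (grad f x) * cos \<phi>"
        using cos const grad_large e by (intro mult_mono) auto
      ultimately have "(1 - \<kappa>arm) * e * cos \<Phi> / C \<le> s" using C by (simp add: field_simps)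
      then show ?thesis by simp
    qed
    then have "\<kappa>bt * min ((cl / Cc)\<^sup>2) ((1 - \<kappa>arm) * e * cos \<Phi> / C) \<le> norm (x - a)"
      unfolding length_a using const by (intro mult_left_mono) auto
    then show ?thesis by simp
  qed
qed

section \<open>Invariants of the algorithm\<close>

lemma rejected_attempts_points:
  assumes "(rejected_attempt ev k J \<kappa>arm \<kappa>bt \<beta>1 x)\<^sup>*\<^sup>* Md Md'" "finite (fst Md)"
  shows "finite (fst Md') \<and> fst Md \<subseteq> fst Md'"
  using assms by (induction rule: rtranclp_induct)
    (auto simp: rejected_attempt_def split: prod.splits if_splits)

text \<open>Each iteration starts with its iterate among the points, and rejected attempts only add
  finitely many. These are the prerequisites for interpolation at \<open>\<mu> i\<close>.\<close>

lemma hktr_points: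
  assumes "hktr ev k J \<kappa>arm \<kappa>bt \<beta>1 \<beta> \<xi>1 \<xi>2 \<mu> M \<delta> p \<phi> a"
  shows "finite (M i)" and "\<mu> i \<in> M i"
proof -
  obtain M0 \<delta>0 where M0: "M0 0 = {\<mu> 0}" "\<And>i. M0 (Suc i) = insert (\<mu> (Suc i)) (M i)"
    and rej: "\<And>i. (rejected_attempt ev k J \<kappa>arm \<kappa>bt \<beta>1 (\<mu> i))\<^sup>*\<^sup>* (M0 i, \<delta>0 i) (M i, \<delta> i)"
    using assms unfolding hktr_def by blast
  have step: "finite (M i) \<and> M0 i \<subseteq> M i" if "finite (M0 i)" for i
    using rejected_attempts_points[OF rej[of i]] that by simp
  have "finite (M0 i) \<and> \<mu> i \<in> M0 i" for i
    by (induction i) (auto simp: M0 step)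
  with step show "finite (M i)" "\<mu> i \<in> M i" by blast+
qed

lemma hktr_first_step:
  assumes "hktr ev k J \<kappa>arm \<kappa>bt \<beta>1 \<beta> \<xi>1 \<xi>2 \<mu> M \<delta> p \<phi> a"
  shows "bt_step (surrogate ev k J (M i)) (tr_constr ev k J (M i) (\<delta> i)) \<kappa>arm \<kappa>bt
    (\<mu> i) (p i) (\<phi> i) (a i)"
proof -
  have "descent_run (surrogate ev k J (M i)) (tr_constr ev k J (M i) (\<delta> i)) \<kappa>arm \<kappa>bt
      (\<mu> i) (p i) (\<phi> i) (a i) (\<mu> (Suc i))"
    using assms unfolding hktr_def by blast
  then show ?thesis unfolding descent_run_def by (metis One_nat_def Suc_le_eq)
qed

section \<open>Convergence of the gradients\<close>

theorem theorem3p7: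
  fixes k :: "real^'p \<Rightarrow> real^'p \<Rightarrow> real"
    and ev :: "'h::{real_inner,complete_space} \<Rightarrow> real^'p \<Rightarrow> real"
    and J :: "real^'p \<Rightarrow> real"
    and \<mu> p a :: "nat \<Rightarrow> real^'p"
    and M :: "nat \<Rightarrow> (real^'p) set"
    and \<delta> \<phi> :: "nat \<Rightarrow> real"
    and \<kappa>arm \<kappa>bt \<beta>1 \<beta> \<xi>1 \<xi>2 Ck \<Phi> cl Cc Cg :: real
  assumes kernel_C2: "C2 (\<lambda>(x, y). k x y)"
    and kernel_spd: "spd_kernel k"
    and native_space: "rkhs k ev"
    and kernel_Lipschitz: "\<And>\<nu> \<nu>1 \<nu>2. \<bar>k \<nu> \<nu>1 - k \<nu> \<nu>2\<bar> \<le> Ck * norm (\<nu>1 - \<nu>2)"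
    and constants: "0 < \<kappa>arm" "\<kappa>arm < 1" "0 < \<kappa>bt" "\<kappa>bt < 1" "0 < \<beta>1" "\<beta>1 < 1"
      "0 < \<beta>" "\<beta> < 1" "0 < \<xi>1" "\<xi>1 < \<xi>2" "\<xi>2 < 1"
    and algorithm: "hktr ev k J \<kappa>arm \<kappa>bt \<beta>1 \<beta> \<xi>1 \<xi>2 \<mu> M \<delta> p \<phi> a"
    and surrogate_twice_diff: "\<And>i. twice_differentiable (surrogate ev k J (M i))"
    and J_lower_bound: "\<exists>c>0. \<forall>\<nu>. J \<nu> > c"
    and surrogate_lower_bound: "\<exists>c>0. \<forall>i \<nu>. surrogate ev k J (M i) \<nu> > c"
    and J_native: "J \<in> range ev"
    and surrogate_Lipschitz: "\<And>i. \<exists>L. L-lipschitz_on UNIV (surrogate ev k J (M i))"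
    and surrogate_grad_Lipschitz: "\<And>i. \<exists>L. L-lipschitz_on UNIV (grad (surrogate ev k J (M i)))"
    and bounds: "\<Phi> < pi / 2" "0 < cl" "0 < Cc" "0 < Cg"
    and angle_bound: "\<And>i. \<phi> i \<le> \<Phi>"
    and constr_bound: "\<And>i. tr_constr ev k J (M i) (\<delta> i) (\<mu> i) \<ge> cl"
    and constr_Hoelder: "\<And>i. \<exists>Cci. 0 < Cci \<and> Cci \<le> Cc \<and>
      (\<forall>\<nu>1 \<nu>2. \<bar>tr_constr ev k J (M i) (\<delta> i) \<nu>1 - tr_constr ev k J (M i) (\<delta> i) \<nu>2\<bar>
                \<le> Cci * sqrt (norm (\<nu>1 - \<nu>2)))"
    and grad_Lipschitz: "\<And>i. \<exists>Cgi. 0 < Cgi \<and> Cgi < Cg \<and>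
      (\<forall>\<nu>1 \<nu>2. norm (grad (surrogate ev k J (M i)) \<nu>1 - grad (surrogate ev k J (M i)) \<nu>2)
                \<le> Cgi * norm (\<nu>1 - \<nu>2))"
    (* The search directions do not degenerate while the gradients do not, which holds, with
       r = e for p i = - grad: without this, arbitrarily short directions can be accepted with
       no backtracking and the claim fails. *)
    and direction_nondegenerate: "\<And>e. e > 0 \<Longrightarrow> \<exists>r>0. \<forall>i.
      norm (grad (surrogate ev k J (M i)) (\<mu> i)) \<ge> e \<longrightarrow> norm (p i) \<ge> r"
    and sufficient_decrease: "\<And>i. J (\<mu> (Suc i)) \<le> surrogate ev k J (M i) (a i)"
  shows "(\<lambda>i. norm (grad J (\<mu> i))) \<longlonglongrightarrow> 0"
proof -
  define Jh where "Jh i = surrogate ev k J (M i)" for i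
  define c where "c i = tr_constr ev k J (M i) (\<delta> i)" for i
  have points: "finite (M i)" "\<mu> i \<in> M i" for i
    using hktr_points[OF algorithm] by auto
  have value_eq: "Jh i (\<mu> i) = J (\<mu> i)" and grad_eq: "grad (Jh i) (\<mu> i) = grad J (\<mu> i)" for i
    using surrogate_interpolates[OF kernel_C2 native_space J_native points] by (auto simp: Jh_def)
  have deriv: "GDERIV (Jh i) z :> grad (Jh i) z" for i z
    unfolding Jh_def surrogate_def by (rule native_function_GDERIV[OF kernel_C2 native_space])
  have step: "bt_step (Jh i) (c i) \<kappa>arm \<kappa>bt (\<mu> i) (p i) (\<phi> i) (a i)" for i
    using hktr_first_step[OF algorithm] by (simp add: Jh_def c_def)
  have phi: "0 \<le> \<phi> i" for i
    using step[of i] by (simp add: bt_step_def is_angle_def)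
  have cos: "0 < cos \<Phi>" "cos \<Phi> \<le> cos (\<phi> i)" for i
    using cos_le_cos_acute[OF phi angle_bound bounds(1)] by auto
  \<comment> \<open>The constants of the single iterations are replaced by their common bounds, so
    that the step length bound below is independent of \<open>i\<close>.\<close>
  have Lip: "norm (grad (Jh i) y - grad (Jh i) z) \<le> Cg * norm (y - z)" for i y z
    using grad_Lipschitz[of i] unfolding Jh_def
    by (meson less_imp_le mult_right_mono norm_ge_zero order_trans)
  have Hoelder: "\<bar>c i y - c i z\<bar> \<le> Cc * sqrt (norm (y - z))" for i y z
    using constr_Hoelder[of i] unfolding c_def
    by (meson mult_right_mono norm_ge_zero order_trans real_sqrt_ge_zero)
  \<comment> \<open>The Armijo inequality for the surrogate transfers to \<open>J\<close>:
    interpolation handles the value and gradient at \<open>\<mu> i\<close>, the sufficient decrease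
    condition the next iterate.\<close>
  have decrease: "J (\<mu> (Suc i)) \<le>
      J (\<mu> i) - \<kappa>arm * norm (grad J (\<mu> i)) * norm (\<mu> i - a i) * cos \<Phi>" for i
  proof -
    have "Jh i (a i) - Jh i (\<mu> i)
        \<le> - (\<kappa>arm * norm (grad (Jh i) (\<mu> i)) * norm (\<mu> i - a i) * cos (\<phi> i))"
      using step[of i] by (auto simp: bt_step_def bt_admissible_def)
    moreover have "\<kappa>arm * norm (grad J (\<mu> i)) * norm (\<mu> i - a i) * cos \<Phi>
        \<le> \<kappa>arm * norm (grad J (\<mu> i)) * norm (\<mu> i - a i) * cos (\<phi> i)"
      using cos(2) constants(1) by (intro mult_left_mono) auto
    ultimately show ?thesis
      using sufficient_decrease[of i, folded Jh_def] by (simp add: value_eq grad_eq)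
  qed
  have "decseq (\<lambda>i. J (\<mu> i))"
  proof (rule decseq_SucI)
    fix i
    have "0 \<le> \<kappa>arm * norm (grad J (\<mu> i)) * norm (\<mu> i - a i) * cos \<Phi>"
      using cos(1) constants(1) by simp
    with decrease[of i] show "J (\<mu> (Suc i)) \<le> J (\<mu> i)" by linarith
  qed
  moreover obtain c0 where "\<And>\<nu>. J \<nu> > c0" using J_lower_bound by blast
  ultimately obtain l where l: "(\<lambda>i. J (\<mu> i)) \<longlonglongrightarrow> l"
    using decseq_convergent[of "\<lambda>i. J (\<mu> i)" c0] less_imp_le by metis
  \<comment> \<open>A bounded monotone sequence converges, so its decrements vanish in the
    limit.\<close>
  have diff: "(\<lambda>i. J (\<mu> i) - J (\<mu> (Suc i))) \<longlonglongrightarrow> 0"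
    using tendsto_diff[OF l LIMSEQ_Suc[OF l]] by simp
  show ?thesis
  proof (rule tendstoI)
    fix e :: real
    assume e: "e > 0"
    obtain r where r: "r > 0"
      "\<And>i. norm (grad (Jh i) (\<mu> i)) \<ge> e \<Longrightarrow> norm (p i) \<ge> r"
      using direction_nondegenerate[OF e] unfolding Jh_def by blast
    define \<sigma> where "\<sigma> = min r (\<kappa>bt * min ((cl / Cc)\<^sup>2) ((1 - \<kappa>arm) * e * cos \<Phi> / Cg))"
    have "\<sigma> > 0" using r(1) constants bounds e cos(1) by (simp add: \<sigma>_def)
    \<comment> \<open>A gradient of norm at least \<open>e\<close> costs a fixed decrease of
      \<open>J\<close>; once the decrements are below that amount, the gradient norm must be below
      \<open>e\<close>.\<close>
    have large: "\<kappa>arm * e * \<sigma> * cos \<Phi> \<le> J (\<mu> i) - J (\<mu> (Suc i))"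
      if grad: "e \<le> norm (grad J (\<mu> i))" for i
    proof -
      have "\<sigma> \<le> norm (\<mu> i - a i)"
        unfolding \<sigma>_def
        by (rule bt_step_length[OF step constants(1-4) deriv Lip bounds(4) angle_bound bounds(1)
              _ bounds(2) Hoelder bounds(3) _ e])
          (use constr_bound grad r(2) in \<open>auto simp: c_def grad_eq\<close>)
      then have "\<kappa>arm * e * \<sigma> * cos \<Phi>
          \<le> \<kappa>arm * norm (grad J (\<mu> i)) * norm (\<mu> i - a i) * cos \<Phi>"
        using grad e \<open>\<sigma> > 0\<close> constants(1) cos(1) by (intro mult_right_mono mult_mono) auto
      with decrease[of i] show ?thesis by linarith
    qed
    have "\<kappa>arm * e * \<sigma> * cos \<Phi> > 0" using e \<open>\<sigma> > 0\<close> constants(1) cos(1) by simp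
    then have "\<forall>\<^sub>F i in sequentially. J (\<mu> i) - J (\<mu> (Suc i)) < \<kappa>arm * e * \<sigma> * cos \<Phi>"
      using order_tendstoD(2)[OF diff] by blast
    then show "\<forall>\<^sub>F i in sequentially. dist (norm (grad J (\<mu> i))) 0 < e"
    proof eventually_elim
      case (elim i)
      then have "\<not> e \<le> norm (grad J (\<mu> i))" using large[of i] by linarith
      then show ?case by simp
    qed
  qed
qed

end
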